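(* Let $r\ge 2$ be an integer and let $E$ be a fibrewise pointed space over $B$. Then $$\mathrm{cat}_B^*(E_B^{r-1})\le \mathrm{TC}_{B,r}(E)\le \mathrm{cat}_B^*(E_B^r).$$
   Context: All spaces are topological spaces, all maps are continuous, $I=[0,1]$. A fibrewise space over $B$ is a space $X$ with a map $p_X\colon X\to B$; a fibrewise map $f\colon X\to Y$ satisfies $p_Y\circ f=p_X$. Subspaces are fibrewise spaces by restriction. Fibrewise maps $f,g\colon X\to Y$ are fibrewise homotopic, $f\simeq_B g$, if there is $H\colon X\times I\to Y$ with $p_Y(H(x,t))=p_X(x)$, $H(\cdot,0)=f$, $H(\cdot,1)=g$. A fibrewise pointed space over $B$ is a fibrewise space $X$ with a section $s_X\colon B\to X$ of $p_X$. $E_B^k$ denotes the $k$-fold fibred product of $E$ over $B$; if $E$ is fibrewise pointed, $E_B^k$ is fibrewise pointed with section $b\mapsto (s_E(b),\dots,s_E(b))$. For a fibrewise pointed space $X$, $\mathrm{cat}_B^*(X)$ (fibrewise unpointed LS category) is the least $n\ge 0$ (or $\infty$) such that $X$ has an open cover $\{U_0,\dots,U_n\}$ with $i_{U_i}\simeq_B s_X\circ p_X|_{U_i}$ as maps $U_i\to X$ for every $i$, where $i_{U_i}$ is the inclusion. For a fibrewise map $f\colon E\to X$, $\mathrm{secat}_B(f)$ is the least $k\ge 0$ (or $\infty$) such that $X$ has an open cover $\{U_0,\dots,U_k\}$ where for each $i$ there is a fibrewise map $s_i\colon U_i\to E$ with $f\circ s_i\simeq_B i_{U_i}$. $P_B(E)=\{(b,\alpha)\in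 B\times E^I\mid p_E\circ\alpha \text{ is constant at } b\}$ (compact-open topology on $E^I$), with projection $(b,\alpha)\mapsto b$; $\Pi_{r,E}\colon P_B(E)\to E_B^r$, $\Pi_{r,E}(b,\gamma)=(\gamma(0),\gamma(\tfrac1{r-1}),\dots,\gamma(1))$; and $\mathrm{TC}_{B,r}(E):=\mathrm{secat}_B(\Pi_{r,E})$. *)

theory Defs
  imports "HOL-Analysis.Analysis" "HOL-Library.Extended_Nat"
begin

(* Spaces are carrier-based topologies. The base topology B is passed separately, and only to those
   notions that depend on it. Values of the maps outside the topspaces are irrelevant. *)

record ('a, 'b) fibrewise_space =
  tspace :: "'a topology"
  proj :: "'a \<Rightarrow> 'b"

record ('a, 'b) fibrewise_pointed_space = "('a, 'b) fibrewise_space" +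
  sect :: "'b \<Rightarrow> 'a"

definition is_fibrewise_space :: "'b topology \<Rightarrow> ('a, 'b, 'm) fibrewise_space_scheme \<Rightarrow> bool" where
  "is_fibrewise_space B X \<longleftrightarrow> continuous_map (tspace X) B (proj X)"

definition is_fibrewise_pointed_space ::
    "'b topology \<Rightarrow> ('a, 'b, 'm) fibrewise_pointed_space_scheme \<Rightarrow> bool" where
  "is_fibrewise_pointed_space B X \<longleftrightarrow>
     is_fibrewise_space B X \<and> continuous_map B (tspace X) (sect X) \<and>
     (\<forall>b\<in>topspace B. proj X (sect X b) = b)"

definition fibrewise_subspace ::
    "('a, 'b, 'm) fibrewise_space_scheme \<Rightarrow> 'a set \<Rightarrow> ('a, 'b) fibrewise_space" where
  "fibrewise_subspace X U = \<lparr>tspace = subtopology (tspace X) U, proj = proj X\<rparr>"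

definition fibrewise_map ::
    "('a, 'b, 'm) fibrewise_space_scheme \<Rightarrow> ('c, 'b, 'n) fibrewise_space_scheme \<Rightarrow> ('a \<Rightarrow> 'c) \<Rightarrow> bool" where
  "fibrewise_map X Y f \<longleftrightarrow>
     continuous_map (tspace X) (tspace Y) f \<and> (\<forall>x\<in>topspace (tspace X). proj Y (f x) = proj X x)"

definition fibrewise_homotopic ::
    "('a, 'b, 'm) fibrewise_space_scheme \<Rightarrow> ('c, 'b, 'n) fibrewise_space_scheme \<Rightarrow>
       ('a \<Rightarrow> 'c) \<Rightarrow> ('a \<Rightarrow> 'c) \<Rightarrow> bool" where
  "fibrewise_homotopic X Y f g \<longleftrightarrow>
     homotopic_with (\<lambda>h. \<forall>x\<in>topspace (tspace X). proj Y (h x) = proj X x) (tspace X) (tspace Y) f g"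

(* The infimum of the empty set in enat is infinity. *)
definition fibrewise_unpointed_cat :: "('a, 'b, 'm) fibrewise_pointed_space_scheme \<Rightarrow> enat" where
  "fibrewise_unpointed_cat X = Inf {enat n | n. \<exists>U :: nat \<Rightarrow> 'a set.
     (\<forall>i\<le>n. openin (tspace X) (U i)) \<and> (\<Union>i\<le>n. U i) = topspace (tspace X) \<and>
     (\<forall>i\<le>n. fibrewise_homotopic (fibrewise_subspace X (U i)) X (\<lambda>x. x) (sect X \<circ> proj X))}"

definition fibrewise_secat ::
    "('e, 'b, 'm) fibrewise_space_scheme \<Rightarrow> ('a, 'b, 'n) fibrewise_space_scheme \<Rightarrow> ('e \<Rightarrow> 'a) \<Rightarrow> enat" where
  "fibrewise_secat E X f = Inf {enat k | k. \<exists>U :: nat \<Rightarrow> 'a set.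
     (\<forall>i\<le>k. openin (tspace X) (U i)) \<and> (\<Union>i\<le>k. U i) = topspace (tspace X) \<and>
     (\<forall>i\<le>k. \<exists>s. fibrewise_map (fibrewise_subspace X (U i)) E s \<and>
        fibrewise_homotopic (fibrewise_subspace X (U i)) X (f \<circ> s) (\<lambda>x. x))}"

(* Points are the tuples (x 0, ..., x (k - 1)), extensional on {..<k}, lying in one fibre.
   This is the k-fold fibred product for k > 0; for k = 0 that product would be the base itself. *)
definition fibred_power ::
    "nat \<Rightarrow> ('a, 'b, 'm) fibrewise_space_scheme \<Rightarrow> (nat \<Rightarrow> 'a, 'b) fibrewise_space" where
  "fibred_power k E =
     \<lparr>tspace = subtopology (product_topology (\<lambda>_. tspace E) {..<k})
        {x. \<forall>i<k. \<forall>j<k. proj E (x i) = proj E (x j)},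
      proj = (\<lambda>x. proj E (x 0))\<rparr>"

definition pointed_fibred_power ::
    "nat \<Rightarrow> ('a, 'b, 'm) fibrewise_pointed_space_scheme \<Rightarrow> (nat \<Rightarrow> 'a, 'b) fibrewise_pointed_space" where
  "pointed_fibred_power k E =
     \<lparr>tspace = tspace (fibred_power k E), proj = proj (fibred_power k E),
      sect = (\<lambda>b. \<lambda>i\<in>{..<k}. sect E b)\<rparr>"

(* Extensionality makes functions correspond to their restrictions to topspace X. *)
definition compact_open_topology :: "'a topology \<Rightarrow> 'c topology \<Rightarrow> ('a \<Rightarrow> 'c) topology" where
  "compact_open_topology X Y = topology_generated_by
     {{f \<in> extensional (topspace X). continuous_map X Y f \<and> f ` K \<subseteq> V} | K V.
        compactin X K \<and> openin Y V}"

definition fibrewise_path_space ::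
    "'b topology \<Rightarrow> ('a, 'b, 'm) fibrewise_space_scheme \<Rightarrow> ('b \<times> (real \<Rightarrow> 'a), 'b) fibrewise_space" where
  "fibrewise_path_space B E =
     \<lparr>tspace = subtopology (prod_topology B (compact_open_topology (top_of_set {0..1}) (tspace E)))
        {(b, \<alpha>). \<forall>t\<in>{0..1}. proj E (\<alpha> t) = b},
      proj = fst\<rparr>"

definition path_evaluation :: "nat \<Rightarrow> 'b \<times> (real \<Rightarrow> 'a) \<Rightarrow> (nat \<Rightarrow> 'a)" where
  "path_evaluation r = (\<lambda>(b, \<gamma>). \<lambda>i\<in>{..<r}. \<gamma> (real i / (real r - 1)))"

definition fibrewise_TC :: "'b topology \<Rightarrow> nat \<Rightarrow> ('a, 'b, 'm) fibrewise_space_scheme \<Rightarrow> enat" where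
  "fibrewise_TC B r E =
     fibrewise_secat (fibrewise_path_space B E) (fibred_power r E) (path_evaluation r)"

lemma topspace_compact_open_topology:
  "topspace (compact_open_topology X Y) = {f \<in> extensional (topspace X). continuous_map X Y f}"
proof -
  have "compactin X {}" "openin Y {}" by auto
  then show ?thesis
    unfolding compact_open_topology_def topology_generated_by_topspace by blast
qed

lemma is_fibrewise_pointed_space_fibred_power:
  assumes "is_fibrewise_pointed_space B E" "k > 0"
  shows "is_fibrewise_pointed_space B (pointed_fibred_power k E)"
proof -
  have p: "continuous_map (tspace E) B (proj E)" and s: "continuous_map B (tspace E) (sect E)"
    and ps: "\<And>b. b \<in> topspace B \<Longrightarrow> proj E (sect E b) = b"
    using assms by (auto simp: is_fibrewise_pointed_space_def is_fibrewise_space_def)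
  have "continuous_map (product_topology (\<lambda>_. tspace E) {..<k}) (tspace E) (\<lambda>x. x 0)"
    using assms(2) by (intro continuous_map_product_projection) auto
  from continuous_map_compose[OF this p]
  have 1: "continuous_map (tspace (fibred_power k E)) B (\<lambda>x. proj E (x 0))"
    by (auto simp: fibred_power_def o_def intro: continuous_map_from_subtopology)
  have 2: "continuous_map B (tspace (fibred_power k E)) (\<lambda>b. \<lambda>i\<in>{..<k}. sect E b)"
    using s by (auto simp: fibred_power_def continuous_map_in_subtopology continuous_map_componentwise)
  show ?thesis
    using 1 2 ps assms(2)
    by (auto simp: is_fibrewise_pointed_space_def is_fibrewise_space_def pointed_fibred_power_def
        fibred_power_def)
qed

end

theory Submission
  imports Defs
begin

text \<open>Both inequalities compare open covers member by member, so that no cover has to be refined.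
  Throughout, \<open>p\<close> and \<open>\<sigma>\<close> are the projection and the section of \<open>E\<close>.

  For the upper bound, let \<open>U\<close> be an open subset of the \<open>r\<close>-th fibred power that contracts
  fibrewise to the section. Sending a tuple over \<open>b\<close> to the constant path at \<open>\<sigma> b\<close> lifts the inclusion
  of \<open>U\<close> to the path space up to fibrewise homotopy, because evaluating this path gives precisely the
  basepoint tuple (lemma \<open>TC_le_cat\<close>).

  For the lower bound, put \<open>n = r - 1\<close> and pull an open subset \<open>U\<close> of the \<open>r\<close>-th fibred power back
  along the embedding \<open>(x\<^sub>1, \<dots>, x\<^sub>n) \<mapsto> (\<sigma> b, x\<^sub>1, \<dots>, x\<^sub>n)\<close>, where \<open>b\<close> is the common value \<open>p x\<^sub>i\<close>. A lift of
  \<open>U\<close> yields paths \<open>\<gamma>\<close> in the fibre over \<open>b\<close>, and three fibrewise homotopies contract the pulled back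
  set: from \<open>x\<^sub>i\<close> to \<open>\<gamma> (i / n)\<close>, then along \<open>\<gamma>\<close> to \<open>\<gamma> 0\<close>, then to \<open>\<sigma> b\<close> (lemma \<open>cat_le_TC\<close>). The outer
  two are components of the homotopy that comes with the lift. The middle one
  (lemma \<open>path_sample_homotopic_initial_point\<close>) is continuous because evaluation is continuous on the
  compact-open topology over the locally compact unit interval (lemma \<open>continuous_map_evaluation\<close>).\<close>

section \<open>The compact-open topology\<close>

text \<open>Continuity may be tested on the generating sets alone, and on the image of \<open>f\<close> the side
  conditions in their definition hold automatically.\<close>

lemma continuous_map_into_compact_open:
  assumes "\<And>x. x \<in> topspace Z \<Longrightarrow> f x \<in> topspace (compact_open_topology X Y)"
    and "\<And>K V. compactin X K \<Longrightarrow> openin Y V \<Longrightarrow> openin Z {x \<in> topspace Z. f x ` K \<subseteq> V}"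
  shows "continuous_map Z (compact_open_topology X Y) f"
  unfolding compact_open_topology_def
proof (rule continuous_on_generated_topo)
  show "f ` topspace Z \<subseteq>
      \<Union>{{f \<in> extensional (topspace X). continuous_map X Y f \<and> f ` K \<subseteq> V} |K V.
          compactin X K \<and> openin Y V}"
    using assms(1)
    unfolding compact_open_topology_def topology_generated_by_topspace by blast
next
  fix U
  assume "U \<in> {{f \<in> extensional (topspace X). continuous_map X Y f \<and> f ` K \<subseteq> V} |K V.
          compactin X K \<and> openin Y V}"
  then obtain K V where U: "U = {f \<in> extensional (topspace X). continuous_map X Y f \<and> f ` K \<subseteq> V}"
    and "compactin X K" "openin Y V"
    by blast
  moreover have "f -` U \<inter> topspace Z = {x \<in> topspace Z. f x ` K \<subseteq> V}"
    using assms(1) by (auto simp: U topspace_compact_open_topology)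
  ultimately show "openin Z (f -` U \<inter> topspace Z)"
    using assms(2) by simp
qed

lemma continuous_map_constant_paths:
  assumes "continuous_map Z Y g"
  shows "continuous_map Z (compact_open_topology X Y) (\<lambda>z. \<lambda>t\<in>topspace X. g z)"
proof (rule continuous_map_into_compact_open)
  fix z assume z: "z \<in> topspace Z"
  then have "continuous_map X Y (\<lambda>t. g z)"
    using assms by (simp add: continuous_map_def Pi_iff)
  then have "continuous_map X Y (\<lambda>t\<in>topspace X. g z)"
    by (rule continuous_map_eq) simp
  then show "(\<lambda>t\<in>topspace X. g z) \<in> topspace (compact_open_topology X Y)"
    by (simp add: topspace_compact_open_topology)
next
  fix K V assume K: "compactin X K" and V: "openin Y V"
  have "K \<subseteq> topspace X"
    using K by (rule compactin_subset_topspace)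
  then have "{z \<in> topspace Z. (\<lambda>t\<in>topspace X. g z) ` K \<subseteq> V} =
      (if K = {} then topspace Z else {z \<in> topspace Z. g z \<in> V})"
    by auto
  then show "openin Z {z \<in> topspace Z. (\<lambda>t\<in>topspace X. g z) ` K \<subseteq> V}"
    using openin_continuous_map_preimage[OF assms V] by auto
qed

text \<open>Evaluation is jointly continuous for a locally compact domain: if \<open>f t \<in> V\<close>, then \<open>t\<close> has a
  compact neighbourhood \<open>K\<close> inside the preimage of \<open>V\<close>, and points of \<open>K\<close> are sent into \<open>V\<close> by all
  maps of the subbasic open set of those carrying \<open>K\<close> into \<open>V\<close>.\<close>

lemma continuous_map_evaluation:
  assumes "neighbourhood_base_of (compactin X) X"
  shows "continuous_map (prod_topology X (compact_open_topology X Y)) Y (\<lambda>(t, f). f t)"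
  unfolding continuous_map_def
proof (intro conjI allI impI)
  show "(\<lambda>(t, f). f t) \<in> topspace (prod_topology X (compact_open_topology X Y)) \<rightarrow> topspace Y"
    by (auto simp: topspace_compact_open_topology continuous_map_def)
next
  fix V assume V: "openin Y V"
  let ?P = "prod_topology X (compact_open_topology X Y)"
  show "openin ?P {z \<in> topspace ?P. (\<lambda>(t, f). f t) z \<in> V}"
  proof (subst openin_subopen, intro ballI)
    fix z assume "z \<in> {z \<in> topspace ?P. (\<lambda>(t, f). f t) z \<in> V}"
    then obtain t f where z: "z = (t, f)" and t: "t \<in> topspace X" and "f t \<in> V"
      and f: "f \<in> extensional (topspace X)" "continuous_map X Y f"
      by (auto simp: topspace_compact_open_topology)
    have "openin X {t \<in> topspace X. f t \<in> V}"
      using f(2) V by (rule openin_continuous_map_preimage)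
    then obtain W K where W: "openin X W" and K: "compactin X K"
      and tW: "t \<in> W" "W \<subseteq> K" "K \<subseteq> {t \<in> topspace X. f t \<in> V}"
      using assms[unfolded neighbourhood_base_of, rule_format,
          of "{t \<in> topspace X. f t \<in> V}" t] t \<open>f t \<in> V\<close> by auto
    let ?N = "{g \<in> extensional (topspace X). continuous_map X Y g \<and> g ` K \<subseteq> V}"
    have N: "openin (compact_open_topology X Y) ?N"
      unfolding compact_open_topology_def using K V by (blast intro: topology_generated_by_Basis)
    have "openin ?P (W \<times> ?N)"
      using W N by (simp add: openin_prod_Times_iff)
    moreover have "z \<in> W \<times> ?N"
      using z f tW by auto
    moreover have "W \<times> ?N \<subseteq> {z \<in> topspace ?P. (\<lambda>(t, f). f t) z \<in> V}"
      using tW openin_subset[OF W]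
      by (auto simp: topspace_compact_open_topology image_subset_iff subset_iff)
    ultimately show "\<exists>T. openin ?P T \<and> z \<in> T \<and> T \<subseteq> {z \<in> topspace ?P. (\<lambda>(t, f). f t) z \<in> V}"
      by blast
  qed
qed

lemma neighbourhood_base_of_compactin_unit_interval:
  "neighbourhood_base_of (compactin (top_of_set {0..1::real})) (top_of_set {0..1})"
proof -
  have "locally_compact_space (top_of_set {0..1::real})"
    by (intro compact_imp_locally_compact_space) (simp add: compact_space_subtopology)
  moreover have "Hausdorff_space (top_of_set {0..1::real})"
    by (simp add: Hausdorff_space_subtopology)
  ultimately show ?thesis
    using locally_compact_space_neighbourhood_base by blast
qed

section \<open>Fibrewise maps and homotopies\<close>

lemma fibrewise_map_compose:
  assumes "fibrewise_map X Y f" "fibrewise_map Y Z g"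
  shows "fibrewise_map X Z (g \<circ> f)"
proof -
  have "f x \<in> topspace (tspace Y)" if "x \<in> topspace (tspace X)" for x
    using assms(1) that by (auto simp: fibrewise_map_def continuous_map_def)
  then show ?thesis
    using assms by (auto simp: fibrewise_map_def intro: continuous_map_compose)
qed

lemma fibrewise_homotopic_compose:
  assumes "fibrewise_homotopic X Y f g" "fibrewise_map X' X h" "fibrewise_map Y Y' k"
  shows "fibrewise_homotopic X' Y' (k \<circ> f \<circ> h) (k \<circ> g \<circ> h)"
proof -
  let ?I = "top_of_set {0..1::real}"
  obtain H where H: "continuous_map (prod_topology ?I (tspace X)) (tspace Y) H"
    and ends: "\<forall>x. H (0, x) = f x" "\<forall>x. H (1, x) = g x"
    and fib: "\<forall>t\<in>{0..1}. \<forall>x\<in>topspace (tspace X). proj Y (H (t, x)) = proj X x"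
    using assms(1) unfolding fibrewise_homotopic_def homotopic_with_def by blast
  have h: "continuous_map (tspace X') (tspace X) h"
    and hfib: "\<forall>x\<in>topspace (tspace X'). proj X (h x) = proj X' x"
    and k: "continuous_map (tspace Y) (tspace Y') k"
    and kfib: "\<forall>x\<in>topspace (tspace Y). proj Y' (k x) = proj Y x"
    using assms(2,3) unfolding fibrewise_map_def by auto
  have "continuous_map (prod_topology ?I (tspace X')) (prod_topology ?I (tspace X))
      (\<lambda>z. (fst z, h (snd z)))"
    using continuous_map_compose[OF continuous_map_snd h]
    by (auto simp: continuous_map_pairwise o_def continuous_map_fst)
  then have "continuous_map (prod_topology ?I (tspace X')) (tspace Y')
      (k \<circ> (H \<circ> (\<lambda>z. (fst z, h (snd z)))))"
    using H k by (meson continuous_map_compose)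
  moreover have "proj Y' (k (H (t, h x))) = proj X' x"
    if "t \<in> {0..1}" "x \<in> topspace (tspace X')" for t x
  proof -
    have "h x \<in> topspace (tspace X)"
      using h that(2) by (auto simp: continuous_map_def)
    moreover from this have "H (t, h x) \<in> topspace (tspace Y)"
      using H that(1) by (auto simp: continuous_map_def)
    ultimately show ?thesis
      using that fib hfib kfib by simp
  qed
  ultimately show ?thesis
    unfolding fibrewise_homotopic_def homotopic_with_def
    using ends by (intro exI[of _ "k \<circ> (H \<circ> (\<lambda>z. (fst z, h (snd z))))"]) auto
qed

lemma fibrewise_homotopic_trans:
  "fibrewise_homotopic X Y f g \<Longrightarrow> fibrewise_homotopic X Y g h \<Longrightarrow> fibrewise_homotopic X Y f h"
  unfolding fibrewise_homotopic_def by (rule homotopic_with_trans)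

lemma fibrewise_homotopic_sym:
  "fibrewise_homotopic X Y f g \<Longrightarrow> fibrewise_homotopic X Y g f"
  unfolding fibrewise_homotopic_def by (rule homotopic_with_symD)

lemma fibrewise_homotopic_eq:
  assumes "fibrewise_homotopic X Y f g"
    and "\<And>x. x \<in> topspace (tspace X) \<Longrightarrow> f' x = f x"
    and "\<And>x. x \<in> topspace (tspace X) \<Longrightarrow> g' x = g x"
  shows "fibrewise_homotopic X Y f' g'"
  using assms unfolding fibrewise_homotopic_def by (rule homotopic_with_eq) simp_all

lemma fibrewise_map_subspace_preimage:
  assumes "fibrewise_map X Y f"
  shows "fibrewise_map (fibrewise_subspace X {x \<in> topspace (tspace X). f x \<in> U})
           (fibrewise_subspace Y U) f"
  using assms unfolding fibrewise_map_def fibrewise_subspace_def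
  by (auto simp: continuous_map_in_subtopology intro: continuous_map_from_subtopology)

section \<open>Fibred powers\<close>

lemma topspace_fibred_power:
  "topspace (tspace (fibred_power k E)) =
     {x \<in> {..<k} \<rightarrow>\<^sub>E topspace (tspace E). \<forall>i<k. \<forall>j<k. proj E (x i) = proj E (x j)}"
  by (auto simp: fibred_power_def)

lemma continuous_map_fibred_power_component:
  assumes "i < k"
  shows "continuous_map (tspace (fibred_power k E)) (tspace E) (\<lambda>x. x i)"
  unfolding fibred_power_def
  using assms by (auto intro: continuous_map_from_subtopology continuous_map_product_projection)

lemma continuous_map_into_fibred_power:
  assumes "\<And>i. i < k \<Longrightarrow> continuous_map Z (tspace E) (\<lambda>z. f z i)"
    and "\<And>i z. i < k \<Longrightarrow> z \<in> topspace Z \<Longrightarrow> proj E (f z i) = q z"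
  shows "continuous_map Z (tspace (fibred_power k E)) (\<lambda>z. \<lambda>i\<in>{..<k}. f z i)"
  using assms by (auto simp: fibred_power_def continuous_map_in_subtopology
      continuous_map_componentwise)

lemma fibrewise_map_into_fibred_power:
  assumes "k > 0" and "\<And>i. i < k \<Longrightarrow> fibrewise_map Z E (\<lambda>z. f z i)"
  shows "fibrewise_map Z (fibred_power k E) (\<lambda>z. \<lambda>i\<in>{..<k}. f z i)"
  unfolding fibrewise_map_def
proof
  show "continuous_map (tspace Z) (tspace (fibred_power k E)) (\<lambda>z. \<lambda>i\<in>{..<k}. f z i)"
    using assms(2) by (intro continuous_map_into_fibred_power[where q = "proj Z"])
      (auto simp: fibrewise_map_def)
  show "\<forall>z\<in>topspace (tspace Z). proj (fibred_power k E) (\<lambda>i\<in>{..<k}. f z i) = proj Z z"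
    using assms by (auto simp: fibred_power_def fibrewise_map_def)
qed

lemma fibrewise_map_fibred_power_component:
  assumes "i < k"
  shows "fibrewise_map (fibred_power k E) E (\<lambda>x. x i)"
  unfolding fibrewise_map_def
proof
  show "continuous_map (tspace (fibred_power k E)) (tspace E) (\<lambda>x. x i)"
    using assms by (rule continuous_map_fibred_power_component)
  have "proj E (x i) = proj E (x 0)" if "x \<in> topspace (tspace (fibred_power k E))" for x
    using that assms gr_zeroI[of k] unfolding topspace_fibred_power by blast
  moreover have "proj (fibred_power k E) x = proj E (x 0)" for x
    by (simp add: fibred_power_def)
  ultimately show "\<forall>x\<in>topspace (tspace (fibred_power k E)). proj E (x i) = proj (fibred_power k E) x"
    by simp
qed

lemma fibrewise_map_section_proj:
  assumes "is_fibrewise_pointed_space B E" "is_fibrewise_space B X"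
  shows "fibrewise_map X E (sect E \<circ> proj X)"
  using assms continuous_map_compose[of "tspace X" B "proj X" "tspace E" "sect E"]
  by (auto simp: fibrewise_map_def is_fibrewise_pointed_space_def is_fibrewise_space_def
      continuous_map_def Pi_iff)

lemma pointed_fibred_power_simps [simp]:
  "tspace (pointed_fibred_power k E) = tspace (fibred_power k E)"
  "proj (pointed_fibred_power k E) = proj (fibred_power k E)"
  "sect (pointed_fibred_power k E) = (\<lambda>b. \<lambda>i\<in>{..<k}. sect E b)"
  by (simp_all add: pointed_fibred_power_def)

lemma is_fibrewise_space_fibred_power:
  assumes "is_fibrewise_pointed_space B E" "k > 0"
  shows "is_fibrewise_space B (fibred_power k E)"
  using is_fibrewise_pointed_space_fibred_power[OF assms]
  by (simp add: is_fibrewise_pointed_space_def is_fibrewise_space_def)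

lemma fibrewise_subspace_pointed_fibred_power [simp]:
  "fibrewise_subspace (pointed_fibred_power k E) U = fibrewise_subspace (fibred_power k E) U"
  by (simp add: fibrewise_subspace_def)

lemma fibrewise_homotopic_pointed_fibred_power [simp]:
  "fibrewise_homotopic X (pointed_fibred_power k E) = fibrewise_homotopic X (fibred_power k E)"
  by (intro ext) (simp add: fibrewise_homotopic_def)

section \<open>The fibrewise path space\<close>

lemma continuous_map_fibrewise_path_evaluation:
  "continuous_map (prod_topology (top_of_set {0..1}) (tspace (fibrewise_path_space B E))) (tspace E)
     (\<lambda>(t, x). snd x t)"
proof -
  let ?I = "top_of_set {0..1::real}" and ?C = "compact_open_topology (top_of_set {0..1::real}) (tspace E)"
  have "continuous_map (tspace (fibrewise_path_space B E)) ?C snd"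
    unfolding fibrewise_path_space_def
    by (auto intro: continuous_map_from_subtopology continuous_map_snd)
  from continuous_map_compose[OF continuous_map_snd this]
  have "continuous_map (prod_topology ?I (tspace (fibrewise_path_space B E))) (prod_topology ?I ?C)
     (\<lambda>z. (fst z, (snd \<circ> snd) z))"
    by (simp add: continuous_map_pairwise o_def continuous_map_fst)
  from continuous_map_compose[OF this
      continuous_map_evaluation[OF neighbourhood_base_of_compactin_unit_interval]]
  show ?thesis
    by (simp add: o_def case_prod_unfold)
qed

lemma continuous_map_reparametrized_evaluation:
  assumes "continuous_map Z (top_of_set {0..1}) \<tau>"
    and "continuous_map Z (tspace (fibrewise_path_space B E)) g"
  shows "continuous_map Z (tspace E) (\<lambda>z. snd (g z) (\<tau> z))"
proof -
  have "continuous_map Z (prod_topology (top_of_set {0..1}) (tspace (fibrewise_path_space B E)))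
     (\<lambda>z. (\<tau> z, g z))"
    using assms by (simp add: continuous_map_pairwise o_def)
  from continuous_map_compose[OF this continuous_map_fibrewise_path_evaluation]
  show ?thesis
    by (simp add: o_def)
qed

lemma fibrewise_path_in_fibre:
  assumes "x \<in> topspace (tspace (fibrewise_path_space B E))" "t \<in> {0..1}"
  shows "proj E (snd x t) = proj (fibrewise_path_space B E) x"
  using assms by (auto simp: fibrewise_path_space_def)

text \<open>A path is contracted to its initial point by slowing it down: at stage \<open>t\<close> the \<open>i\<close>-th sample is
  taken at time \<open>t * \<tau> i\<close>. Each path lies in one fibre, so this never leaves the fibred power.\<close>

lemma path_sample_homotopic_initial_point:
  assumes k: "k > 0" and \<tau>: "\<And>i. i < k \<Longrightarrow> \<tau> i \<in> {0..1}"
  shows "fibrewise_homotopic (fibrewise_path_space B E) (fibred_power k E)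
     (\<lambda>x. \<lambda>i\<in>{..<k}. snd x 0) (\<lambda>x. \<lambda>i\<in>{..<k}. snd x (\<tau> i))"
proof -
  let ?P = "fibrewise_path_space B E" and ?I = "top_of_set {0..1::real}"
  let ?H = "\<lambda>z. \<lambda>i\<in>{..<k}. snd (snd z) (fst z * \<tau> i)"
  have in_I: "t * \<tau> i \<in> {0..1}" if "t \<in> {0..1}" "i < k" for t i
    using that \<tau>[OF that(2)] by (auto intro: mult_le_one)
  have "continuous_map (prod_topology ?I (tspace ?P)) (tspace (fibred_power k E)) ?H"
  proof (rule continuous_map_into_fibred_power)
    fix i assume i: "i < k"
    have "continuous_map (prod_topology ?I (tspace ?P)) euclideanreal (\<lambda>z. fst z * \<tau> i)"
      using continuous_map_into_fulltopology[OF continuous_map_fst]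
      by (intro continuous_map_real_mult) auto
    then have "continuous_map (prod_topology ?I (tspace ?P)) ?I (\<lambda>z. fst z * \<tau> i)"
      using in_I i by (auto simp: continuous_map_in_subtopology)
    then show "continuous_map (prod_topology ?I (tspace ?P)) (tspace E)
        (\<lambda>z. snd (snd z) (fst z * \<tau> i))"
      by (rule continuous_map_reparametrized_evaluation) (rule continuous_map_snd)
  next
    fix i z assume "i < k" "z \<in> topspace (prod_topology ?I (tspace ?P))"
    then show "proj E (snd (snd z) (fst z * \<tau> i)) = proj ?P (snd z)"
      using in_I by (intro fibrewise_path_in_fibre) auto
  qed
  moreover have "proj (fibred_power k E) (?H (t, x)) = proj ?P x"
    if "t \<in> {0..1}" "x \<in> topspace (tspace ?P)" for t x
    using fibrewise_path_in_fibre[OF that(2) in_I[OF that(1) k]] k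
    by (simp add: fibred_power_def)
  ultimately show ?thesis
    unfolding fibrewise_homotopic_def homotopic_with_def
    by (intro exI[of _ ?H]) auto
qed

lemma fibrewise_map_constant_path:
  assumes "is_fibrewise_pointed_space B E" "is_fibrewise_space B X"
  shows "fibrewise_map X (fibrewise_path_space B E)
     (\<lambda>x. (proj X x, \<lambda>t\<in>{0..1}. sect E (proj X x)))"
proof -
  have sp: "continuous_map (tspace X) (tspace E) (\<lambda>x. sect E (proj X x))"
    "\<forall>x\<in>topspace (tspace X). proj E (sect E (proj X x)) = proj X x"
    using fibrewise_map_section_proj[OF assms] by (auto simp: fibrewise_map_def o_def)
  have "continuous_map (tspace X) B (proj X)"
    using assms(2) by (simp add: is_fibrewise_space_def)
  then show ?thesis
    using sp continuous_map_constant_paths[OF sp(1), of "top_of_set {0..1::real}"]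
    by (auto simp: fibrewise_map_def fibrewise_path_space_def continuous_map_in_subtopology
        continuous_map_pairwise o_def)
qed

section \<open>The two inequalities\<close>

text \<open>The local sections demanded by the topological complexity are sections only up to fibrewise
  homotopy. Hence the constant path at the basepoint of the fibre can serve over every \<open>U\<close>: its
  samples form the basepoint of the fibred power, to which \<open>U\<close> contracts.\<close>

lemma TC_le_cat:
  assumes "r > 0" and E: "is_fibrewise_pointed_space B E"
  shows "fibrewise_TC B r E \<le> fibrewise_unpointed_cat (pointed_fibred_power r E)"
proof -
  let ?X = "fibred_power r E"
  have X: "is_fibrewise_space B ?X"
    using E assms(1) by (rule is_fibrewise_space_fibred_power)
  define c where "c = (\<lambda>x. (proj ?X x, \<lambda>t\<in>{0..1::real}. sect E (proj ?X x)))"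
  have ev: "path_evaluation r (c x) = (\<lambda>i\<in>{..<r}. sect E (proj ?X x))" for x
    by (auto simp: path_evaluation_def c_def divide_le_eq)
  have lift: "\<exists>s. fibrewise_map (fibrewise_subspace ?X U) (fibrewise_path_space B E) s \<and>
        fibrewise_homotopic (fibrewise_subspace ?X U) ?X (path_evaluation r \<circ> s) (\<lambda>x. x)"
    if "fibrewise_homotopic (fibrewise_subspace ?X U) ?X (\<lambda>x. x)
          (sect (pointed_fibred_power r E) \<circ> proj ?X)" for U
  proof (intro exI conjI)
    have "is_fibrewise_space B (fibrewise_subspace ?X U)"
      using X by (auto simp: is_fibrewise_space_def fibrewise_subspace_def
          intro: continuous_map_from_subtopology)
    from fibrewise_map_constant_path[OF E this]
    show "fibrewise_map (fibrewise_subspace ?X U) (fibrewise_path_space B E) c"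
      by (simp add: c_def fibrewise_subspace_def)
    have "path_evaluation r \<circ> c = sect (pointed_fibred_power r E) \<circ> proj ?X"
      by (simp add: fun_eq_iff ev)
    then show "fibrewise_homotopic (fibrewise_subspace ?X U) ?X (path_evaluation r \<circ> c) (\<lambda>x. x)"
      using fibrewise_homotopic_sym[OF that] by simp
  qed
  show ?thesis
    unfolding fibrewise_TC_def fibrewise_secat_def fibrewise_unpointed_cat_def
  proof (rule Inf_superset_mono, clarify)
    fix k :: nat and U
    assume U: "\<forall>i\<le>k. openin (tspace (pointed_fibred_power r E)) (U i)"
        "(\<Union>i\<le>k. U i) = topspace (tspace (pointed_fibred_power r E))"
      and h: "\<forall>i\<le>k. fibrewise_homotopic (fibrewise_subspace (pointed_fibred_power r E) (U i))
        (pointed_fibred_power r E) (\<lambda>x. x)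
        (sect (pointed_fibred_power r E) \<circ> proj (pointed_fibred_power r E))"
    have "\<exists>s. fibrewise_map (fibrewise_subspace ?X (U i)) (fibrewise_path_space B E) s \<and>
        fibrewise_homotopic (fibrewise_subspace ?X (U i)) ?X (path_evaluation r \<circ> s) (\<lambda>x. x)"
      if "i \<le> k" for i
      using h that by (intro lift) simp
    then show "\<exists>k'. enat k = enat k' \<and> (\<exists>V. (\<forall>i\<le>k'. openin (tspace ?X) (V i)) \<and>
        (\<Union>i\<le>k'. V i) = topspace (tspace ?X) \<and>
        (\<forall>i\<le>k'. \<exists>s. fibrewise_map (fibrewise_subspace ?X (V i)) (fibrewise_path_space B E) s \<and>
          fibrewise_homotopic (fibrewise_subspace ?X (V i)) ?X (path_evaluation r \<circ> s) (\<lambda>x. x)))"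
      using U by (intro exI[of _ k] conjI refl exI[of _ U]) simp_all
  qed
qed

text \<open>Prefixing the basepoint embeds the \<open>n\<close>-th fibred power into the next one, and the cover is
  pulled back along this embedding \<open>j\<close>. A lift \<open>s\<close> up to homotopy assigns to \<open>x\<close> a path whose sample
  tuple is homotopic to \<open>j x\<close>; sliding its later samples along the path to its initial point moves the
  copy of \<open>x\<close> to a copy of the basepoint.\<close>

lemma cat_le_TC:
  fixes E :: "('a, 'b, 'm) fibrewise_pointed_space_scheme"
  assumes "n > 0" and E: "is_fibrewise_pointed_space B E"
  shows "fibrewise_unpointed_cat (pointed_fibred_power n E) \<le> fibrewise_TC B (Suc n) E"
proof -
  let ?X = "fibred_power n E" and ?Y = "fibred_power (Suc n) E" and ?P = "fibrewise_path_space B E"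
  define j where "j = (\<lambda>x. \<lambda>i\<in>{..<Suc n}. case i of 0 \<Rightarrow> sect E (proj ?X x) | Suc i \<Rightarrow> x i)"
  define tail where "tail = (\<lambda>y :: nat \<Rightarrow> 'a. \<lambda>i\<in>{..<n}. y (Suc i))"
  define head where "head = (\<lambda>y :: nat \<Rightarrow> 'a. \<lambda>i\<in>{..<n}. y 0)"
  have j: "fibrewise_map ?X ?Y j"
    unfolding j_def
  proof (rule fibrewise_map_into_fibred_power)
    fix i assume "i < Suc n"
    then show "fibrewise_map ?X E (\<lambda>x. case i of 0 \<Rightarrow> sect E (proj ?X x) | Suc i \<Rightarrow> x i)"
      using fibrewise_map_section_proj[OF E is_fibrewise_space_fibred_power[OF E assms(1)]]
      by (cases i) (auto simp: o_def intro: fibrewise_map_fibred_power_component)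
  qed simp
  have tail: "fibrewise_map ?Y ?X tail" and head: "fibrewise_map ?Y ?X head"
    unfolding tail_def head_def using assms(1)
    by (auto intro!: fibrewise_map_into_fibred_power fibrewise_map_fibred_power_component)
  have tail_j: "tail (j x) = x" if "x \<in> topspace (tspace ?X)" for x
    using that by (auto simp: tail_def j_def topspace_fibred_power PiE_def extensional_def)
  have head_j: "head (j x) = sect (pointed_fibred_power n E) (proj ?X x)" for x
    by (auto simp: head_def j_def)
  have contract: "fibrewise_homotopic ?P ?X (tail \<circ> path_evaluation (Suc n))
      (head \<circ> path_evaluation (Suc n))"
  proof (rule fibrewise_homotopic_sym, rule fibrewise_homotopic_eq)
    show "fibrewise_homotopic ?P ?X (\<lambda>x. \<lambda>i\<in>{..<n}. snd x 0)
        (\<lambda>x. \<lambda>i\<in>{..<n}. snd x (real (Suc i) / real n))"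
      using assms(1) by (intro path_sample_homotopic_initial_point) (auto simp: divide_le_eq)
  qed (auto simp: tail_def head_def path_evaluation_def case_prod_unfold)
  have contractible: "fibrewise_homotopic (fibrewise_subspace ?X {x \<in> topspace (tspace ?X). j x \<in> U}) ?X
      (\<lambda>x. x) (sect (pointed_fibred_power n E) \<circ> proj ?X)"
    if s: "fibrewise_map (fibrewise_subspace ?Y U) ?P s"
      and h: "fibrewise_homotopic (fibrewise_subspace ?Y U) ?Y (path_evaluation (Suc n) \<circ> s) (\<lambda>y. y)"
    for U s
  proof -
    let ?V = "fibrewise_subspace ?X {x \<in> topspace (tspace ?X). j x \<in> U}"
    have j': "fibrewise_map ?V (fibrewise_subspace ?Y U) j"
      using j by (rule fibrewise_map_subspace_preimage)
    have V: "topspace (tspace ?V) \<subseteq> topspace (tspace ?X)"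
      by (auto simp: fibrewise_subspace_def)
    have id: "fibrewise_map ?X ?X (\<lambda>x. x)"
      by (simp add: fibrewise_map_def)
    \<comment> \<open>The homotopy \<open>h\<close> is used twice: its components after the first lead from \<open>x\<close> to the later
      samples of the path, and its first component leads from the initial point to the basepoint.\<close>
    have "fibrewise_homotopic ?V ?X (\<lambda>x. x) (tail \<circ> path_evaluation (Suc n) \<circ> (s \<circ> j))"
      by (rule fibrewise_homotopic_eq
          [OF fibrewise_homotopic_compose[OF fibrewise_homotopic_sym[OF h] j' tail]])
        (use V tail_j in auto)
    also have "fibrewise_homotopic ?V ?X \<dots> (head \<circ> path_evaluation (Suc n) \<circ> (s \<circ> j))"
      by (rule fibrewise_homotopic_eq
          [OF fibrewise_homotopic_compose[OF contract fibrewise_map_compose[OF j' s] id]]) auto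
    also (fibrewise_homotopic_trans)
    have "fibrewise_homotopic ?V ?X \<dots> (sect (pointed_fibred_power n E) \<circ> proj ?X)"
      by (rule fibrewise_homotopic_eq[OF fibrewise_homotopic_compose[OF h j' head]])
        (use head_j in auto)
    finally (fibrewise_homotopic_trans) show ?thesis .
  qed
  have jc: "continuous_map (tspace ?X) (tspace ?Y) j"
    using j by (simp add: fibrewise_map_def)
  show ?thesis
    unfolding fibrewise_TC_def fibrewise_secat_def fibrewise_unpointed_cat_def
  proof (rule Inf_superset_mono, clarify)
    fix k :: nat and U
    assume U: "\<forall>i\<le>k. openin (tspace ?Y) (U i)" "(\<Union>i\<le>k. U i) = topspace (tspace ?Y)"
      and s: "\<forall>i\<le>k. \<exists>s. fibrewise_map (fibrewise_subspace ?Y (U i)) ?P s \<and>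
        fibrewise_homotopic (fibrewise_subspace ?Y (U i)) ?Y (path_evaluation (Suc n) \<circ> s) (\<lambda>x. x)"
    let ?V = "\<lambda>i. {x \<in> topspace (tspace ?X). j x \<in> U i}"
    have "\<forall>i\<le>k. openin (tspace ?X) (?V i)"
      using U(1) openin_continuous_map_preimage[OF jc] by auto
    moreover have "(\<Union>i\<le>k. ?V i) = topspace (tspace ?X)"
    proof -
      have "j x \<in> (\<Union>i\<le>k. U i)" if "x \<in> topspace (tspace ?X)" for x
        using jc that unfolding U(2) by (auto simp: continuous_map_def)
      then show ?thesis by auto
    qed
    moreover have "\<forall>i\<le>k. fibrewise_homotopic (fibrewise_subspace ?X (?V i)) ?X
        (\<lambda>x. x) (sect (pointed_fibred_power n E) \<circ> proj ?X)"
      using s contractible by blast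
    ultimately show "\<exists>k'. enat k = enat k' \<and> (\<exists>V.
        (\<forall>i\<le>k'. openin (tspace (pointed_fibred_power n E)) (V i)) \<and>
        (\<Union>i\<le>k'. V i) = topspace (tspace (pointed_fibred_power n E)) \<and>
        (\<forall>i\<le>k'. fibrewise_homotopic (fibrewise_subspace (pointed_fibred_power n E) (V i))
           (pointed_fibred_power n E) (\<lambda>x. x)
           (sect (pointed_fibred_power n E) \<circ> proj (pointed_fibred_power n E))))"
      by (intro exI[of _ k] conjI refl exI[of _ ?V]) simp_all
  qed
qed

theorem proposition3p4:
  fixes B :: "'b topology" and E :: "('a, 'b) fibrewise_pointed_space" and r :: nat
  assumes "r \<ge> 2" and "is_fibrewise_pointed_space B E"
  shows "fibrewise_unpointed_cat (pointed_fibred_power (r - 1) E) \<le> fibrewise_TC B r E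
    \<and> fibrewise_TC B r E \<le> fibrewise_unpointed_cat (pointed_fibred_power r E)"
  using assms cat_le_TC[of "r - 1" B E] TC_le_cat[of r B E] by simp

end
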